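(* Let $f \in \mathbb{C}[X]$ be a nonzero polynomial. Then the set $$K_f^{\geq 0}=\bigcup_{k>0}\{A\in \mathrm{Mat}_{k\times k}(\mathbb{Z}_{\geq 0}) : A \text{ is irreducible and } f(A)=0\}$$ of all irreducible non-negative square integer matrices (of any size $k\geq 1$) annihilated by $f$ is finite.
   Context: A square matrix $A$ with real entries is non-negative if all its entries are $\geq 0$. A non-negative $k\times k$ matrix $A$ is irreducible if for every pair of indices $i,j\in\{1,\dots,k\}$ there exists $m\geq 1$ such that the $(i,j)$ entry of $A^m$ is positive. *)

theory Defs
  imports "Jordan_Normal_Form.Matrix" "HOL-Computational_Algebra.Polynomial" Complex_Main
begin

definition nonneg_mat :: "'a :: linordered_idom mat \<Rightarrow> bool" where
  "nonneg_mat A \<longleftrightarrow> square_mat A \<and> (\<forall>i < dim_row A. \<forall>j < dim_col A. A $$ (i, j) \<ge> 0)"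

text \<open>The exponent has to be positive, so the \<open>1 \<times> 1\<close> zero matrix is not irreducible.\<close>

definition irreducible_nonneg_mat :: "'a :: linordered_idom mat \<Rightarrow> bool" where
  "irreducible_nonneg_mat A \<longleftrightarrow> nonneg_mat A \<and>
     (\<forall>i < dim_row A. \<forall>j < dim_row A. \<exists>m \<ge> 1. (A ^\<^sub>m m) $$ (i, j) > 0)"

text \<open>The type of matrices has no zero element (dimensions vary), so the sum is taken in the ring
  of \<open>n \<times> n\<close> matrices, where \<open>n\<close> is the dimension of the square argument.\<close>

definition poly_mat :: "'a :: comm_ring_1 poly \<Rightarrow> 'a mat \<Rightarrow> 'a mat" where
  "poly_mat f A = finsum (ring_mat TYPE('a) (dim_row A) ())
     (\<lambda>i. coeff f i \<cdot>\<^sub>m (A ^\<^sub>m i)) {..degree f}"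

lemma poly_mat_carrier:
  assumes "A \<in> carrier_mat n n"
  shows "poly_mat f A \<in> carrier_mat n n"
proof -
  interpret semiring "ring_mat TYPE('a) n ()" by (rule semiring_mat)
  have "(\<lambda>i. coeff f i \<cdot>\<^sub>m (A ^\<^sub>m i)) \<in> {..degree f} \<rightarrow> carrier (ring_mat TYPE('a) n ())"
    using assms by (auto simp: ring_mat_simps)
  from finsum_closed[OF this] show ?thesis
    using assms by (simp add: poly_mat_def ring_mat_simps carrier_matD)
qed

lemma poly_mat_index:
  assumes A: "A \<in> carrier_mat n n" and ij: "i < n" "j < n"
  shows "poly_mat f A $$ (i, j) = (\<Sum>k \<le> degree f. coeff f k * (A ^\<^sub>m k) $$ (i, j))"
proof -
  let ?R = "ring_mat TYPE('a) n ()"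
  let ?g = "\<lambda>k. coeff f k \<cdot>\<^sub>m (A ^\<^sub>m k)"
  interpret semiring ?R by (rule semiring_mat)
  have g: "?g k \<in> carrier ?R" for k using A by (simp add: ring_mat_simps)
  have "finsum ?R ?g S \<in> carrier_mat n n \<and>
      finsum ?R ?g S $$ (i, j) = (\<Sum>k \<in> S. ?g k $$ (i, j))" if "finite S" for S
    using that
  proof induction
    case empty
    show ?case using ij by (simp add: ring_mat_simps)
  next
    case (insert x S)
    have "finsum ?R ?g (insert x S) = ?g x + finsum ?R ?g S"
      using insert.hyps g finsum_insert[of S x ?g] by (auto simp: ring_mat_simps Pi_def)
    moreover have "dim_row (finsum ?R ?g S) = n" "dim_col (finsum ?R ?g S) = n"
      using insert.IH by auto
    ultimately show ?case using insert A ij by simp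
  qed
  from this[of "{..degree f}"] show ?thesis
    using A ij unfolding poly_mat_def by (simp add: carrier_matD)
qed

definition K_nonneg :: "complex poly \<Rightarrow> int mat set" where
  "K_nonneg f = (\<Union>k \<in> {0<..}. {A \<in> carrier_mat k k.
     irreducible_nonneg_mat A \<and> poly_mat f (map_mat complex_of_int A) = 0\<^sub>m k k})"

end

theory Submission
  imports Defs
begin

text \<open>
  Let \<open>d\<close> be the degree of \<open>f\<close>. If \<open>f(A) = 0\<close>, every entry of \<open>A\<^sup>n\<close>, as a sequence in \<open>n\<close>, satisfies
  the linear recurrence with characteristic polynomial \<open>f\<close>. Hence it is \<open>O(R\<^sup>n)\<close> with \<open>R\<close> depending
  only on \<open>f\<close> (the implied constant may depend on \<open>A\<close>), and if it vanishes for \<open>1 \<le> n \<le> d\<close>, it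
  vanishes for all \<open>n \<ge> 1\<close>. So for irreducible \<open>A\<close> every position is positive in one of
  \<open>A, \<dots>, A\<^sup>d\<close>, i.e. \<open>A + \<dots> + A\<^sup>d\<close> has all entries at least \<open>1\<close>.

  \<^item> Multiplying \<open>A\<^sup>n\<close> by this sum shows that the row sums of \<open>A\<^sup>n\<close> grow by a factor of at
    least \<open>k / d\<close> within \<open>d\<close> steps, whence \<open>k \<le> d R\<^sup>d\<close> for the size \<open>k\<close> of \<open>A\<close>.
  \<^item> An entry \<open>a\<close> at position \<open>(i, j)\<close> closes up to a cycle of length \<open>p \<le> d + 1\<close>, so
    \<open>a\<^sup>n\<close> is at most a diagonal entry of \<open>A\<^bsup>pn\<^esup>\<close>, whence \<open>a \<le> R\<^bsup>d+1\<^esup>\<close>.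
\<close>

section \<open>Linear recurrences\<close>

definition satisfies_recurrence :: "'a :: comm_semiring_1 poly \<Rightarrow> (nat \<Rightarrow> 'a) \<Rightarrow> bool" where
  "satisfies_recurrence f x \<longleftrightarrow> (\<forall>n. (\<Sum>k\<le>degree f. coeff f k * x (n + k)) = 0)"

text \<open>A Cauchy-type bound: for \<open>f \<noteq> 0\<close> it is at least the modulus of every
  root of \<open>f\<close>. The summand 1 makes its powers monotone in the exponent.\<close>

definition recurrence_rate :: "'a :: real_normed_field poly \<Rightarrow> real" where
  "recurrence_rate f = 1 + (\<Sum>k<degree f. norm (coeff f k)) / norm (lead_coeff f)"

lemma recurrence_rate_ge_1: "recurrence_rate f \<ge> 1"
  by (simp add: recurrence_rate_def sum_nonneg)

lemma satisfies_recurrence_step: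
  fixes f :: "'a :: comm_ring_1 poly"
  assumes "satisfies_recurrence f x"
  shows "lead_coeff f * x (n + degree f) = - (\<Sum>k<degree f. coeff f k * x (n + k))"
  using assms unfolding satisfies_recurrence_def
  by (simp add: lessThan_Suc_atMost[symmetric] eq_neg_iff_add_eq_0 add.commute[of "sum _ _"])

lemma satisfies_recurrence_growth:
  fixes f :: "'a :: real_normed_field poly"
  assumes "f \<noteq> 0" and x: "satisfies_recurrence f x"
  shows "\<exists>C. \<forall>n. norm (x n) \<le> C * recurrence_rate f ^ n"
proof -
  let ?d = "degree f" and ?R = "recurrence_rate f" and ?l = "norm (lead_coeff f)"
  define C where "C = (\<Sum>k<?d. norm (x k))"
  have C: "C \<ge> 0" by (simp add: C_def sum_nonneg)
  have R: "?R \<ge> 1" by (rule recurrence_rate_ge_1)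
  have l: "?l > 0" using assms by simp
  have S: "(\<Sum>k<?d. norm (coeff f k)) \<le> ?l * ?R"
    using l by (simp add: recurrence_rate_def field_simps)
  have "norm (x n) \<le> C * ?R ^ n" for n
  proof (induction n rule: less_induct)
    case (less n)
    show ?case
    proof (cases "n < ?d")
      case True
      then have "norm (x n) \<le> C" unfolding C_def by (intro member_le_sum) auto
      also have "\<dots> \<le> C * ?R ^ n" using C R by (simp add: mult_le_cancel_left1)
      finally show ?thesis .
    next
      case False
      then obtain m where n: "n = m + ?d" by (metis add.commute le_add_diff_inverse not_less)
      \<comment> \<open>The extra factor \<open>?R\<close> lifts the bounds at indices below
        \<open>n\<close> to exponent \<open>n\<close>; it is cancelled at the end.\<close>
      have "?R * (?l * norm (x n)) = ?R * norm (\<Sum>k<?d. coeff f k * x (m + k))"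
        using satisfies_recurrence_step[OF x, of m] n by (metis norm_minus_cancel norm_mult)
      also have "\<dots> \<le> ?R * (\<Sum>k<?d. norm (coeff f k) * norm (x (m + k)))"
        using R by (intro mult_left_mono order_trans[OF norm_sum]) (auto simp: norm_mult)
      also have "\<dots> = (\<Sum>k<?d. norm (coeff f k) * (?R * norm (x (m + k))))"
        by (simp add: sum_distrib_left mult_ac)
      also have "\<dots> \<le> (\<Sum>k<?d. norm (coeff f k) * (C * ?R ^ n))"
      proof (intro sum_mono mult_left_mono)
        fix k assume k: "k \<in> {..<?d}"
        have "?R * norm (x (m + k)) \<le> ?R * (C * ?R ^ (m + k))"
          using less.IH[of "m + k"] k n R by (intro mult_left_mono) auto
        also have "\<dots> = C * ?R ^ Suc (m + k)" by simp
        also have "\<dots> \<le> C * ?R ^ n"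
          using k n R C by (intro mult_left_mono power_increasing) auto
        finally show "?R * norm (x (m + k)) \<le> C * ?R ^ n" .
      qed simp
      also have "\<dots> = (\<Sum>k<?d. norm (coeff f k)) * (C * ?R ^ n)" by (simp add: sum_distrib_right)
      also have "\<dots> \<le> (?l * ?R) * (C * ?R ^ n)"
        using S C R by (intro mult_right_mono) auto
      finally have "(?R * ?l) * norm (x n) \<le> (?R * ?l) * (C * ?R ^ n)" by (simp add: mult_ac)
      then show ?thesis using R l by (simp add: mult_le_cancel_left_pos)
    qed
  qed
  then show ?thesis by blast
qed

text \<open>For \<open>n > degree f\<close> the recurrence gives \<open>x n\<close> from terms whose
  indices are still at least 1. The value \<open>x 0\<close> stays free, as it must:
  \<open>A ^\<^sub>m 0\<close> is the identity.\<close>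

lemma satisfies_recurrence_eq_0:
  fixes f :: "'a :: idom poly"
  assumes "f \<noteq> 0" and x: "satisfies_recurrence f x"
    and zero: "\<And>n. 1 \<le> n \<Longrightarrow> n \<le> degree f \<Longrightarrow> x n = 0" and "n \<ge> 1"
  shows "x n = 0"
  using \<open>n \<ge> 1\<close>
proof (induction n rule: less_induct)
  case (less n)
  show ?case
  proof (cases "n \<le> degree f")
    case False
    then obtain m where n: "n = m + degree f" and m: "m \<ge> 1"
      using that[of "n - degree f"] by simp
    have "(\<Sum>k<degree f. coeff f k * x (m + k)) = 0"
      using less.IH n m by (intro sum.neutral) auto
    then show ?thesis using satisfies_recurrence_step[OF x, of m] n \<open>f \<noteq> 0\<close> by simp
  qed (use zero less in auto)
qed

text \<open>Comparing exponential rates discards the constant \<open>C\<close>, which may depend on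
  the matrix.\<close>

lemma le_of_power_le_const_mult_power:
  fixes a b C :: real
  assumes "b > 0" and le: "\<And>n. a ^ n \<le> C * b ^ n"
  shows "a \<le> b"
proof (rule ccontr)
  assume "\<not> a \<le> b"
  then have "1 < a / b" using \<open>b > 0\<close> by simp
  from real_arch_pow[OF this] obtain n where "C < (a / b) ^ n" by blast
  then have "C * b ^ n < a ^ n" using \<open>b > 0\<close> by (simp add: power_divide field_simps)
  with le[of n] show False by simp
qed

section \<open>Powers of non-negative matrices\<close>

lemma pow_mat_add:
  fixes A :: "'a :: semiring_1 mat"
  assumes "A \<in> carrier_mat k k"
  shows "A ^\<^sub>m (p + q) = A ^\<^sub>m p * A ^\<^sub>m q"
proof (induction q)
  case 0
  show ?case using assms right_mult_one_mat[OF pow_carrier_mat[OF assms, of p]] by simp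
next
  case (Suc q)
  show ?case using Suc assms by (simp add: assoc_mult_mat[of _ k k _ k _ k])
qed

lemma pow_mat_add_index:
  fixes A :: "'a :: semiring_1 mat"
  assumes "A \<in> carrier_mat k k" "i < k" "j < k"
  shows "(A ^\<^sub>m (p + q)) $$ (i, j) = (\<Sum>l<k. (A ^\<^sub>m p) $$ (i, l) * (A ^\<^sub>m q) $$ (l, j))"
  using assms by (simp add: pow_mat_add scalar_prod_def lessThan_atLeast0)

lemma nonneg_matD:
  assumes "nonneg_mat A" "A \<in> carrier_mat k k" "i < k" "j < k"
  shows "A $$ (i, j) \<ge> 0"
  using assms by (auto simp: nonneg_mat_def)

lemma nonneg_mat_pow:
  fixes A :: "'a :: linordered_idom mat"
  assumes "nonneg_mat A" and A: "A \<in> carrier_mat k k" and "i < k" "j < k"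
  shows "(A ^\<^sub>m n) $$ (i, j) \<ge> 0"
  using assms(3,4)
proof (induction n arbitrary: i j)
  case 0
  then show ?case using A by (simp add: one_mat_def)
next
  case (Suc n)
  have "(A ^\<^sub>m Suc n) $$ (i, j) = (\<Sum>l<k. (A ^\<^sub>m n) $$ (i, l) * A $$ (l, j))"
    using A Suc.prems by (simp add: scalar_prod_def lessThan_atLeast0)
  also have "\<dots> \<ge> 0"
    using Suc nonneg_matD[OF assms(1) A] by (intro sum_nonneg mult_nonneg_nonneg) auto
  finally show ?case .
qed

lemma nonneg_mat_pow_add_ge:
  fixes A :: "'a :: linordered_idom mat"
  assumes "nonneg_mat A" "A \<in> carrier_mat k k" "i < k" "j < k" "l < k"
  shows "(A ^\<^sub>m p) $$ (i, l) * (A ^\<^sub>m q) $$ (l, j) \<le> (A ^\<^sub>m (p + q)) $$ (i, j)"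
  unfolding pow_mat_add_index[OF assms(2-4)]
  using assms nonneg_mat_pow[OF assms(1,2)]
  by (intro member_le_sum[of l "{..<k}" "\<lambda>l. (A ^\<^sub>m p) $$ (i, l) * (A ^\<^sub>m q) $$ (l, j)"]) auto

text \<open>In terms of weighted walks: closed walks of length \<open>p\<close> at \<open>i\<close>
  can be concatenated \<open>n\<close> times.\<close>

lemma nonneg_mat_diag_power_le:
  fixes A :: "'a :: linordered_idom mat"
  assumes "nonneg_mat A" "A \<in> carrier_mat k k" "i < k"
  shows "((A ^\<^sub>m p) $$ (i, i)) ^ n \<le> (A ^\<^sub>m (p * n)) $$ (i, i)"
proof (induction n)
  case 0
  show ?case using assms by simp
next
  case (Suc n)
  have "((A ^\<^sub>m p) $$ (i, i)) ^ Suc n \<le> (A ^\<^sub>m p) $$ (i, i) * (A ^\<^sub>m (p * n)) $$ (i, i)"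
    using Suc nonneg_mat_pow[OF assms(1,2)] assms(3) by (simp add: mult_left_mono)
  also have "\<dots> \<le> (A ^\<^sub>m (p + p * n)) $$ (i, i)"
    using assms by (intro nonneg_mat_pow_add_ge) auto
  finally show ?case by simp
qed

lemma finite_bounded_mats:
  "finite {A \<in> carrier_mat k k. \<forall>i<k. \<forall>j<k. A $$ (i, j) \<in> {0..N :: int}}"
proof (rule finite_subset)
  show "finite ((\<lambda>g. mat k k g) ` (({..<k} \<times> {..<k}) \<rightarrow>\<^sub>E {0..N}))"
    by (intro finite_imageI finite_PiE) auto
  show "{A \<in> carrier_mat k k. \<forall>i<k. \<forall>j<k. A $$ (i, j) \<in> {0..N}}
      \<subseteq> (\<lambda>g. mat k k g) ` (({..<k} \<times> {..<k}) \<rightarrow>\<^sub>E {0..N})"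
  proof
    fix A assume A: "A \<in> {A \<in> carrier_mat k k. \<forall>i<k. \<forall>j<k. A $$ (i, j) \<in> {0..N}}"
    have "A = mat k k (restrict (\<lambda>ij. A $$ ij) ({..<k} \<times> {..<k}))"
      using A by (intro eq_matI) auto
    moreover have "restrict (\<lambda>ij. A $$ ij) ({..<k} \<times> {..<k}) \<in> ({..<k} \<times> {..<k}) \<rightarrow>\<^sub>E {0..N}"
      using A by auto
    ultimately show "A \<in> (\<lambda>g. mat k k g) ` (({..<k} \<times> {..<k}) \<rightarrow>\<^sub>E {0..N})" by blast
  qed
qed

section \<open>Bounds for annihilated irreducible matrices\<close>

text \<open>The recurrence at \<open>n\<close> is the entry \<open>(i, j)\<close> of the product of
  \<open>f(A) = 0\<close> with the \<open>n\<close>-th power of \<open>A\<close>.\<close>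

lemma poly_mat_zero_satisfies_recurrence:
  fixes A :: "'a :: comm_ring_1 mat"
  assumes A: "A \<in> carrier_mat k k" and f: "poly_mat f A = 0\<^sub>m k k" and ij: "i < k" "j < k"
  shows "satisfies_recurrence f (\<lambda>n. (A ^\<^sub>m n) $$ (i, j))"
  unfolding satisfies_recurrence_def
proof
  fix n
  have "(\<Sum>m\<le>degree f. coeff f m * (A ^\<^sub>m (n + m)) $$ (i, j))
      = (\<Sum>m\<le>degree f. \<Sum>l<k. (coeff f m * (A ^\<^sub>m m) $$ (i, l)) * (A ^\<^sub>m n) $$ (l, j))"
    using pow_mat_add_index[OF A ij, of _ n]
    by (simp add: add.commute[of n] sum_distrib_left mult.assoc)
  also have "\<dots> = (\<Sum>l<k. poly_mat f A $$ (i, l) * (A ^\<^sub>m n) $$ (l, j))"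
    by (subst sum.swap, intro sum.cong refl)
      (simp add: poly_mat_index[OF A ij(1)] sum_distrib_right)
  also have "\<dots> = 0" using f ij by simp
  finally show "(\<Sum>m\<le>degree f. coeff f m * (A ^\<^sub>m (n + m)) $$ (i, j)) = 0" .
qed

locale annihilated_irreducible_mat =
  fixes f :: "complex poly" and A :: "int mat" and k :: nat
  assumes f_nonzero: "f \<noteq> 0"
    and carrier: "A \<in> carrier_mat k k"
    and irreducible: "irreducible_nonneg_mat A"
    and annihilated: "poly_mat f (map_mat complex_of_int A) = 0\<^sub>m k k"
begin

abbreviation "d \<equiv> degree f"
abbreviation "R \<equiv> recurrence_rate f"

lemma nonneg: "nonneg_mat A"
  using irreducible by (simp add: irreducible_nonneg_mat_def)

lemma entries_satisfy_recurrence: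
  assumes "i < k" "j < k"
  shows "satisfies_recurrence f (\<lambda>n. complex_of_int ((A ^\<^sub>m n) $$ (i, j)))"
proof -
  have "(map_mat complex_of_int A ^\<^sub>m n) $$ (i, j) = complex_of_int ((A ^\<^sub>m n) $$ (i, j))" for n
    using assms carrier by (simp add: of_int_hom.mat_hom_pow[OF carrier, symmetric])
  then show ?thesis
    using poly_mat_zero_satisfies_recurrence[OF _ annihilated assms] carrier by simp
qed

lemma entries_growth:
  assumes "i < k" "j < k"
  shows "\<exists>C. \<forall>n. real_of_int ((A ^\<^sub>m n) $$ (i, j)) \<le> C * R ^ n"
proof -
  obtain C where "\<And>n. norm (complex_of_int ((A ^\<^sub>m n) $$ (i, j))) \<le> C * R ^ n"
    using satisfies_recurrence_growth[OF f_nonzero entries_satisfy_recurrence[OF assms]] by blast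
  then show ?thesis by (metis norm_of_int abs_le_D1 of_int_abs)
qed

text \<open>A non-negative integer below 1 is 0, so otherwise the entry would vanish in the first
  \<open>d\<close> positive powers, hence in all of them, against irreducibility.\<close>

lemma positive_power_le_degree:
  assumes "i < k" "j < k"
  shows "\<exists>m. 1 \<le> m \<and> m \<le> d \<and> (A ^\<^sub>m m) $$ (i, j) \<ge> 1"
proof (rule ccontr)
  assume neg: "\<not> ?thesis"
  have "(A ^\<^sub>m m) $$ (i, j) = 0" if "1 \<le> m" "m \<le> d" for m
    using neg that nonneg_mat_pow[OF nonneg carrier assms, of m] by force
  then have "(A ^\<^sub>m m) $$ (i, j) = 0" if "m \<ge> 1" for m
    using satisfies_recurrence_eq_0[OF f_nonzero entries_satisfy_recurrence[OF assms] _ that] by simp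
  moreover obtain m where "m \<ge> 1" "(A ^\<^sub>m m) $$ (i, j) > 0"
    using irreducible assms carrier by (auto simp: irreducible_nonneg_mat_def)
  ultimately show False by force
qed

lemma entry_le:
  assumes "i < k" "j < k"
  shows "real_of_int (A $$ (i, j)) \<le> R ^ Suc d"
proof -
  obtain m where m: "m \<le> d" "(A ^\<^sub>m m) $$ (j, i) \<ge> 1"
    using positive_power_le_degree assms by blast
  let ?a = "(A ^\<^sub>m (m + 1)) $$ (j, j)"
  \<comment> \<open>Returning from \<open>j\<close> to \<open>i\<close> in \<open>m\<close> steps
    and then stepping to \<open>j\<close> closes the entry up to a cycle at
    \<open>j\<close>.\<close>
  have "A $$ (i, j) \<le> (A ^\<^sub>m m) $$ (j, i) * (A ^\<^sub>m 1) $$ (i, j)"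
    using m nonneg_matD[OF nonneg carrier assms] carrier
    by (simp add: mult_le_cancel_right1)
  also have "\<dots> \<le> ?a"
    using nonneg carrier assms by (intro nonneg_mat_pow_add_ge) auto
  finally have a: "A $$ (i, j) \<le> ?a" .
  obtain C where C: "\<And>n. real_of_int ((A ^\<^sub>m n) $$ (j, j)) \<le> C * R ^ n"
    using entries_growth assms by blast
  have "real_of_int ?a \<le> R ^ (m + 1)"
  proof (rule le_of_power_le_const_mult_power)
    show "R ^ (m + 1) > 0" using recurrence_rate_ge_1[of f] by simp
    fix n
    have "real_of_int ?a ^ n = real_of_int (?a ^ n)" by simp
    also have "\<dots> \<le> real_of_int ((A ^\<^sub>m ((m + 1) * n)) $$ (j, j))"
      using nonneg_mat_diag_power_le[OF nonneg carrier assms(2)] of_int_le_iff by blast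
    also have "\<dots> \<le> C * (R ^ (m + 1)) ^ n" using C by (metis power_mult)
    finally show "real_of_int ?a ^ n \<le> C * (R ^ (m + 1)) ^ n" .
  qed
  also have "\<dots> \<le> R ^ Suc d"
    using m recurrence_rate_ge_1 by (intro power_increasing) auto
  finally show ?thesis using a by linarith
qed

section \<open>Bounding the size through the growth of a row sum\<close>

definition row_sum :: "nat \<Rightarrow> int" where
  "row_sum n = (\<Sum>j<k. (A ^\<^sub>m n) $$ (0, j))"

text \<open>The right side sums row 0 of the \<open>n\<close>-th power times
  \<open>A + ... + A^d\<close>. All entries of the second factor are at least 1, so each of the
  \<open>k\<close> columns contributes at least \<open>row_sum n\<close>.\<close>

lemma row_sum_step:
  assumes "k > 0"
  shows "int k * row_sum n \<le> (\<Sum>m=1..d. row_sum (n + m))"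
proof -
  have "int k * row_sum n = (\<Sum>j<k. \<Sum>l<k. (A ^\<^sub>m n) $$ (0, l))"
    by (simp add: row_sum_def)
  also have "\<dots> \<le> (\<Sum>j<k. \<Sum>l<k. (A ^\<^sub>m n) $$ (0, l) * (\<Sum>m=1..d. (A ^\<^sub>m m) $$ (l, j)))"
  proof (intro sum_mono)
    fix j l assume jl: "j \<in> {..<k}" "l \<in> {..<k}"
    then obtain m where m: "m \<in> {1..d}" "(A ^\<^sub>m m) $$ (l, j) \<ge> 1"
      using positive_power_le_degree[of l j] by auto
    have "(A ^\<^sub>m m) $$ (l, j) \<le> (\<Sum>m=1..d. (A ^\<^sub>m m) $$ (l, j))"
      using m(1) jl nonneg_mat_pow[OF nonneg carrier]
      by (intro member_le_sum[of m "{1..d}" "\<lambda>m. (A ^\<^sub>m m) $$ (l, j)"]) auto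
    with m have "1 \<le> (\<Sum>m=1..d. (A ^\<^sub>m m) $$ (l, j))" by linarith
    moreover have "(A ^\<^sub>m n) $$ (0, l) \<ge> 0"
      using nonneg_mat_pow[OF nonneg carrier] assms jl by auto
    ultimately show "(A ^\<^sub>m n) $$ (0, l) \<le> (A ^\<^sub>m n) $$ (0, l) * (\<Sum>m=1..d. (A ^\<^sub>m m) $$ (l, j))"
      by (simp add: mult_le_cancel_left1)
  qed
  also have "\<dots> = (\<Sum>j<k. \<Sum>m=1..d. \<Sum>l<k. (A ^\<^sub>m n) $$ (0, l) * (A ^\<^sub>m m) $$ (l, j))"
    by (simp only: sum_distrib_left sum.swap[of _ "{..<k}" "{1..d}"])
  also have "\<dots> = (\<Sum>j<k. \<Sum>m=1..d. (A ^\<^sub>m (n + m)) $$ (0, j))"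
    using assms by (intro sum.cong refl) (simp add: pow_mat_add_index[OF carrier])
  also have "\<dots> = (\<Sum>m=1..d. row_sum (n + m))"
    unfolding row_sum_def by (rule sum.swap)
  finally show ?thesis .
qed

text \<open>Growth by \<open>k / d\<close> per round, iterated \<open>l\<close> times; denominators
  are cleared to stay in the integers.\<close>

lemma row_sum_lower_bound:
  assumes "k > 0"
  shows "\<exists>n \<le> d * l. int k ^ l \<le> int d ^ l * row_sum n"
proof (induction l)
  case 0
  have "row_sum 0 = 1"
    using carrier assms by (simp add: row_sum_def sum.delta)
  then show ?case by simp
next
  case (Suc l)
  then obtain n where n: "n \<le> d * l" "int k ^ l \<le> int d ^ l * row_sum n" by blast
  \<comment> \<open>Pigeonhole: one of the \<open>d\<close> summands in \<open>row_sum_step\<close>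
    is at least their average.\<close>
  have "\<exists>m\<in>{1..d}. int k * row_sum n \<le> int d * row_sum (n + m)"
  proof (rule ccontr)
    assume neg: "\<not> ?thesis"
    have "d > 0" using positive_power_le_degree[OF assms assms] by auto
    have "int d * (\<Sum>m=1..d. row_sum (n + m)) = (\<Sum>m=1..d. int d * row_sum (n + m))"
      by (simp add: sum_distrib_left)
    also have "\<dots> < (\<Sum>m=1..d. int k * row_sum n)"
      using neg \<open>d > 0\<close> by (intro sum_strict_mono) (auto simp: not_le)
    also have "\<dots> = int d * (int k * row_sum n)" by simp
    finally show False using row_sum_step[OF assms, of n] \<open>d > 0\<close> by simp
  qed
  then obtain m where m: "m \<in> {1..d}" "int k * row_sum n \<le> int d * row_sum (n + m)" by blast
  have "int k ^ Suc l \<le> int d ^ l * (int k * row_sum n)"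
    using mult_left_mono[OF n(2), of "int k"] by (simp add: mult_ac)
  also have "\<dots> \<le> int d ^ l * (int d * row_sum (n + m))"
    using m(2) by (intro mult_left_mono) auto
  finally have "int k ^ Suc l \<le> int d ^ Suc l * row_sum (n + m)" by (simp add: mult_ac)
  moreover have "n + m \<le> d * Suc l" using n m by simp
  ultimately show ?case by blast
qed

lemma size_le:
  assumes "k > 0"
  shows "real k \<le> real d * R ^ d"
proof -
  have "\<forall>j<k. \<exists>C. \<forall>n. real_of_int ((A ^\<^sub>m n) $$ (0, j)) \<le> C * R ^ n"
    using entries_growth assms by blast
  then obtain C where C: "\<And>j n. j < k \<Longrightarrow> real_of_int ((A ^\<^sub>m n) $$ (0, j)) \<le> C j * R ^ n"
    by metis
  \<comment> \<open>The absolute value makes \<open>D\<close> non-negative, so that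
    \<open>D * R ^ n\<close> can be enlarged to \<open>D * R ^ (d * l)\<close>: only
    \<open>n \<le> d * l\<close> is known.\<close>
  define D where "D = \<bar>\<Sum>j<k. C j\<bar>"
  have D: "real_of_int (row_sum n) \<le> D * R ^ n" for n
  proof -
    have "real_of_int (row_sum n) \<le> (\<Sum>j<k. C j * R ^ n)"
      using C by (auto simp: row_sum_def intro: sum_mono)
    also have "\<dots> = (\<Sum>j<k. C j) * R ^ n" by (simp add: sum_distrib_right)
    also have "\<dots> \<le> D * R ^ n"
      using recurrence_rate_ge_1[of f] by (intro mult_right_mono) (auto simp: D_def)
    finally show ?thesis .
  qed
  have "d > 0" using positive_power_le_degree[OF assms assms] by auto
  show ?thesis
  proof (rule le_of_power_le_const_mult_power)
    show "real d * R ^ d > 0" using recurrence_rate_ge_1[of f] \<open>d > 0\<close> by simp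
    fix l
    obtain n where n: "n \<le> d * l" "int k ^ l \<le> int d ^ l * row_sum n"
      using row_sum_lower_bound[OF assms] by blast
    have "real k ^ l = real_of_int (int k ^ l)" by simp
    also have "\<dots> \<le> real_of_int (int d ^ l * row_sum n)" using n(2) of_int_le_iff by blast
    also have "\<dots> = real d ^ l * real_of_int (row_sum n)" by simp
    also have "\<dots> \<le> real d ^ l * (D * R ^ n)" using D by (intro mult_left_mono) auto
    also have "\<dots> \<le> real d ^ l * (D * R ^ (d * l))"
      using n(1) recurrence_rate_ge_1[of f]
      by (intro mult_left_mono power_increasing) (auto simp: D_def)
    also have "\<dots> = D * (real d * R ^ d) ^ l" by (simp add: power_mult_distrib power_mult)
    finally show "real k ^ l \<le> D * (real d * R ^ d) ^ l" .
  qed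
qed

end

theorem theoremA:
  fixes f :: "complex poly"
  assumes "f \<noteq> 0"
  shows "finite (K_nonneg f)"
proof (rule finite_subset)
  let ?R = "recurrence_rate f"
  \<comment> \<open>Both bounds depend on \<open>f\<close> alone; rounding down loses nothing for
    integers.\<close>
  define M where "M = nat \<lfloor>real (degree f) * ?R ^ degree f\<rfloor>"
  define N where "N = \<lfloor>?R ^ Suc (degree f)\<rfloor>"
  let ?B = "\<Union>k\<le>M. {A \<in> carrier_mat k k. \<forall>i<k. \<forall>j<k. A $$ (i, j) \<in> {0..N}}"
  show "finite ?B" using finite_bounded_mats by blast
  show "K_nonneg f \<subseteq> ?B"
  proof
    fix A assume "A \<in> K_nonneg f"
    then obtain k where "k > 0" and A: "A \<in> carrier_mat k k" "irreducible_nonneg_mat A"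
      "poly_mat f (map_mat complex_of_int A) = 0\<^sub>m k k"
      by (auto simp: K_nonneg_def)
    then interpret annihilated_irreducible_mat f A k
      using assms by unfold_locales
    have "k \<le> M" using size_le[OF \<open>k > 0\<close>] unfolding M_def by (simp add: le_nat_iff le_floor_iff)
    moreover have "A $$ (i, j) \<in> {0..N}" if "i < k" "j < k" for i j
      using entry_le[OF that] nonneg_matD[OF nonneg A(1) that] by (simp add: N_def le_floor_iff)
    ultimately show "A \<in> ?B" using A(1) by blast
  qed
qed

end
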